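(* Consider the two-domain overset problem for $(\mathbf u,\mathbf v)$ with penalty functions $\mathcal P^b_u,\mathcal P^b_v$ on $\Gamma_b$ and $\mathcal P^c_u,\mathcal P^c_v$ on $\Gamma_c$, as specified in the context, with weighting parameter $0<\eta<1$. On each interface $\Gamma_\alpha$, $\alpha\in\{b,c\}$, define $$\mathcal B \equiv \big(\vec f^{\,\epsilon}(\mathbf u)-\vec f^{\,\epsilon}(\mathbf v)\big)\cdot\vec\beta+\mathbf w(\mathbf u)^T\mathcal P^\alpha_u(\mathbf u,\mathbf v)+\mathbf w(\mathbf v)^T\mathcal P^\alpha_v(\mathbf u,\mathbf v),\qquad \vec\beta=\begin{cases}-\eta\,\hat n_b, & \vec x\in\Gamma_b,\\ (1-\eta)\,\hat n_c, & \vec x\in\Gamma_c.\end{cases}$$ If $\mathcal B\ge 0$ on each interface curve $\Gamma_b$ and $\Gamma_c$, then the total entropy $\bar S$ is bounded by initial and physical boundary data, in the sense that $$\frac{d\bar S}{dt}\le -\left\{\int_{\Gamma_a}\vec f^{\,\epsilon}(\mathbf u)\cdot\hat n_a\,dS+\int_{\Gamma_d}\vec f^{\,\epsilon}(\mathbf v)\cdot\hat n_d\,dS\right\}.$$ (The overset domain problem is defined to be entropy preserving if $\mathcal B=0$ on each interface boundary.)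
   Context: **Conservation law and entropy.** $\partial_t\boldsymbol\omega+\vec\nabla_x\cdot\mathbf f(\boldsymbol\omega)=0$ on $\Omega\subset\mathbb R^d$ is a system of $p$ conservation laws with flux $\mathbf f=\sum_{i=1}^d\mathbf f_i(\boldsymbol\omega)\hat x_i$, $\mathbf f_i(\boldsymbol\omega)\in\mathbb R^p$. It has an entropy pair $(s,\vec f^{\,\epsilon})$: $s$ is a convex scalar function of the state, $\vec f^{\,\epsilon}=(f^\epsilon_1,\dots,f^\epsilon_d)$ is the entropy flux, and with the entropy variables $\mathbf w(\boldsymbol\omega)=\partial s/\partial\boldsymbol\omega$ one has, for smooth states, $\mathbf w^T\partial_t\boldsymbol\omega=\partial_t s(\boldsymbol\omega)$ and $\mathbf w^T\,\vec\nabla_x\cdot\mathbf f=\vec\nabla_x\cdot\vec f^{\,\epsilon}$. **Geometry.** $\Omega=\Omega_u\cup\Omega_v$, where the overset domain $\Omega_u$ and the base domain $\Omega_v$ overlap in $\Omega_O=\Omega_u\cap\Omega_v$. Put $\Omega_{\bar u}=\Omega_u\setminus\Omega_O$ and $\Omega_{\bar v}=\Omega_v\setminus\Omega_O$. The physical boundary of $\Omega$ is $\Gamma_a\cup\Gamma_d$. The boundary of $\Omega_u$ is $\Gamma_a\cup\Gamma_c$ and that of $\Omega_v$ is $\Gamma_b\cup\Gamma_d$, where $\Gamma_b,\Gamma_c$ are artificial interfaces. Thus $\partial\Omega_{\bar u}=\Gamma_a\cup\Gamma_b$, $\partial\Omega_O=\Gamma_b\cup\Gamma_c$, $\partial\Omega_{\bar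 v}=\Gamma_c\cup\Gamma_d$. The unit normals $\hat n_a,\hat n_c$ point out of $\Omega_u$ and $\hat n_b,\hat n_d$ point out of $\Omega_v$ (so $\hat n_b$ and $\hat n_c$ both point out of $\Omega_O$). All domains and boundaries are regular enough for Gauss' law. **Overset domain problem.** The unknowns are $\mathbf u$ on $\Omega_u$ and $\mathbf v$ on $\Omega_v$, assumed smooth enough in space for the entropy contractions and Gauss' law to hold. The penalty functions $\mathcal P^\alpha_u(\mathbf u,\mathbf v),\mathcal P^\alpha_v(\mathbf u,\mathbf v)\in\mathbb R^p$, $\alpha\in\{b,c\}$, are defined along $\Gamma_\alpha$ and vanish when their two arguments are equal. The strong form is $$\partial_t\mathbf u+\vec\nabla_x\cdot\mathbf f(\mathbf u)+\mathcal L^b[\mathcal P^b_u]+\mathcal L^c[\mathcal P^c_u]=0\ \text{ in }\Omega_u,\qquad \partial_t\mathbf v+\vec\nabla_x\cdot\mathbf f(\mathbf v)+\mathcal L^b[\mathcal P^b_v]+\mathcal L^c[\mathcal P^c_v]=0\ \text{ in }\Omega_v,$$ where $\mathcal L^\alpha$ is the lifting operator: $\int\boldsymbol\psi^T\mathcal L^\alpha[\mathbf q]\,dV=\int_{\Gamma_\alpha}\boldsymbol\psi^T\mathbf q\,dS$. It is understood in weak form. With $\langle\mathbf a,\mathbf b\rangle_V=\int_V\mathbf a^T\mathbf b\,d\vec x$, for all test functions, $$\langle\boldsymbol\phi_u,\partial_t\mathbf u\rangle_{\Omega_u}+\langle\boldsymbol\phi_u,\vec\nabla_x\cdot\mathbf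 f(\mathbf u)\rangle_{\Omega_u}+\int_{\Gamma_b}\boldsymbol\phi_u^T\mathcal P^b_u\,dS+\int_{\Gamma_c}\boldsymbol\phi_u^T\mathcal P^c_u\,dS=0,$$ $$\langle\boldsymbol\phi_v,\partial_t\mathbf v\rangle_{\Omega_v}+\langle\boldsymbol\phi_v,\vec\nabla_x\cdot\mathbf f(\mathbf v)\rangle_{\Omega_v}+\int_{\Gamma_b}\boldsymbol\phi_v^T\mathcal P^b_v\,dS+\int_{\Gamma_c}\boldsymbol\phi_v^T\mathcal P^c_v\,dS=0.$$ By convention the penalties are not applied to the overlap region: over $\Omega_O$ one has $\langle\boldsymbol\phi,\partial_t\mathbf u+\vec\nabla_x\cdot\mathbf f(\mathbf u)\rangle_{\Omega_O}=0$ and $\langle\boldsymbol\phi,\partial_t\mathbf v+\vec\nabla_x\cdot\mathbf f(\mathbf v)\rangle_{\Omega_O}=0$. The pairings with the time derivatives are taken to be the quantities given by these identities. **Total entropy.** For fixed $0<\eta<1$, let $S=s(\mathbf u)$ on $\Omega_{\bar u}$, $S=(1-\eta)s(\mathbf u)+\eta s(\mathbf v)$ on $\Omega_O$, $S=s(\mathbf v)$ on $\Omega_{\bar v}$, and $\bar S=\int_\Omega S\,d\vec x$. Its time derivative is $\frac{d\bar S}{dt}=\langle\partial_tS,1\rangle_\Omega$, that is, $$\frac{d\bar S}{dt}=\langle\mathbf w(\mathbf u),\partial_t\mathbf u\rangle_{\Omega_u}+\langle\mathbf w(\mathbf v),\partial_t\mathbf v\rangle_{\Omega_v}-\eta\langle\mathbf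 w(\mathbf u),\partial_t\mathbf u\rangle_{\Omega_O}-(1-\eta)\langle\mathbf w(\mathbf v),\partial_t\mathbf v\rangle_{\Omega_O}.$$ *)

theory Defs
  imports "HOL-Analysis.Analysis"
begin

section \<open>Surface measure\<close>

text \<open>Hausdorff measure of integer dimension \<open>m\<close>, with the normalisation that agrees with Lebesgue
  measure on \<open>m\<close>-dimensional planes. The empty set has weight 0 also for \<open>m = 0\<close>, so that
  \<open>m = 0\<close> gives counting measure.\<close>

definition hausdorff_weight :: "nat \<Rightarrow> 'a::metric_space set \<Rightarrow> ennreal" where
  "hausdorff_weight m C =
     (if C = {} then 0 else ennreal (unit_ball_vol (real m) * (diameter C / 2) ^ m))"

definition hausdorff_pre :: "nat \<Rightarrow> real \<Rightarrow> 'a::metric_space set \<Rightarrow> ennreal" where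
  "hausdorff_pre m \<delta> A =
     (INF C \<in> {C :: nat \<Rightarrow> 'a set. A \<subseteq> (\<Union>i. C i) \<and> (\<forall>i. bounded (C i) \<and> diameter (C i) \<le> \<delta>)}.
        \<Sum>i. hausdorff_weight m (C i))"

definition hausdorff_outer :: "nat \<Rightarrow> 'a::metric_space set \<Rightarrow> ennreal" where
  "hausdorff_outer m A = (SUP \<delta> \<in> {0<..}. hausdorff_pre m \<delta> A)"

text \<open>\<^const>\<open>hausdorff_outer\<close> is a metric outer measure, hence countably additive on the Borel
  sets; the degenerate case of \<^const>\<open>measure_of\<close> does not arise.\<close>

definition hausdorff_measure :: "nat \<Rightarrow> 'a::metric_space measure" where
  "hausdorff_measure m = measure_of UNIV (sets borel) (hausdorff_outer m)"

definition surface_measure :: "(real^'d) measure" where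
  "surface_measure = hausdorff_measure (CARD('d) - 1)"

definition surface_integral :: "(real^'d) set \<Rightarrow> (real^'d \<Rightarrow> real) \<Rightarrow> real" where
  "surface_integral \<Gamma> g = (LINT x:\<Gamma>|surface_measure. g x)"


section \<open>Smooth fields, divergence, Gauss' law\<close>

definition C1_on :: "'a::real_normed_vector set \<Rightarrow> ('a \<Rightarrow> 'b::real_normed_vector) \<Rightarrow> bool" where
  "C1_on D F \<longleftrightarrow> (\<exists>F' :: 'a \<Rightarrow> 'a \<Rightarrow>\<^sub>L 'b.
     (\<forall>x\<in>D. (F has_derivative blinfun_apply (F' x)) (at x)) \<and> continuous_on D F')"

text \<open>For open \<open>D\<close>: the field is continuously differentiable in \<open>D\<close>, and the field and its
  derivative extend continuously to the closure.\<close>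

definition C1_closure :: "'a::real_normed_vector set \<Rightarrow> ('a \<Rightarrow> 'b::real_normed_vector) \<Rightarrow> bool" where
  "C1_closure D F \<longleftrightarrow> continuous_on (closure D) F \<and> (\<exists>F' :: 'a \<Rightarrow> 'a \<Rightarrow>\<^sub>L 'b.
     (\<forall>x\<in>D. (F has_derivative blinfun_apply (F' x)) (at x)) \<and> continuous_on (closure D) F')"

text \<open>The entries of the flux may be vectors: with \<open>'b = real^'p\<close> this is the divergence
  \<open>\<Sum>i. \<partial>\<^sub>i f\<^sub>i\<close> of a system flux, with \<open>'b = real\<close> that of a vector field.\<close>

definition divergence :: "(real^'d \<Rightarrow> 'b::real_normed_vector^'d) \<Rightarrow> real^'d \<Rightarrow> 'b" where
  "divergence F x = (\<Sum>i\<in>UNIV. frechet_derivative F (at x) (axis i 1) $ i)"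

text \<open>Near \<open>x\<close>, and outside arbitrarily flat cones around the tangent plane, \<open>D\<close> is
  exactly the side to which \<open>- n\<close> points.\<close>

definition outward_unit_normal :: "'a::real_inner set \<Rightarrow> 'a \<Rightarrow> 'a \<Rightarrow> bool" where
  "outward_unit_normal D x n \<longleftrightarrow> norm n = 1 \<and>
     (\<forall>\<epsilon>>0. \<exists>\<delta>>0. \<forall>y. 0 < dist y x \<and> dist y x < \<delta> \<longrightarrow>
        ((y - x) \<bullet> n \<le> - \<epsilon> * dist y x \<longrightarrow> y \<in> D) \<and>
        ((y - x) \<bullet> n \<ge> \<epsilon> * dist y x \<longrightarrow> y \<notin> D))"

text \<open>The normal is required only almost everywhere, which admits edges and corners.\<close>

definition outward_normal_field :: "(real^'d) set \<Rightarrow> (real^'d) set \<Rightarrow> (real^'d \<Rightarrow> real^'d) \<Rightarrow> bool" where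
  "outward_normal_field D \<Gamma> n \<longleftrightarrow> set_borel_measurable borel \<Gamma> n \<and>
     (AE x in surface_measure. x \<in> \<Gamma> \<longrightarrow> outward_unit_normal D x (n x))"

definition gauss_regular :: "(real^'d) set \<Rightarrow> bool" where
  "gauss_regular D \<longleftrightarrow>
     (\<forall>n F. outward_normal_field D (frontier D) n \<longrightarrow> C1_closure D F \<longrightarrow>
        set_integrable lborel D (divergence F) \<and>
        set_integrable surface_measure (frontier D) (\<lambda>x. F x \<bullet> n x) \<and>
        (LINT x:D|lborel. divergence F x) = surface_integral (frontier D) (\<lambda>x. F x \<bullet> n x))"


section \<open>Entropy pairs\<close>

definition entropy_vars :: "(real^'p \<Rightarrow> real) \<Rightarrow> real^'p \<Rightarrow> real^'p" where
  "entropy_vars s \<omega> = (\<chi> j. frechet_derivative s (at \<omega>) (axis j 1))"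

text \<open>\<open>W\<close> is the set of admissible states, \<open>f \<omega> $ i\<close> the flux in direction \<open>i\<close>.
  The contraction of the time derivative with the entropy variables is the chain rule for
  \<open>s\<close>, so only the contraction of the flux has to be required.\<close>

definition entropy_pair ::
  "(real^'p) set \<Rightarrow> (real^'p \<Rightarrow> (real^'p)^'d) \<Rightarrow> (real^'p \<Rightarrow> real) \<Rightarrow> (real^'p \<Rightarrow> real^'d) \<Rightarrow> bool" where
  "entropy_pair W f s fe \<longleftrightarrow>
     convex_on W s \<and> C1_on W s \<and> C1_on W fe \<and>
     (\<forall>D (\<omega> :: real^'d \<Rightarrow> real^'p). open D \<longrightarrow> C1_on D \<omega> \<longrightarrow> \<omega> ` D \<subseteq> W \<longrightarrow>
        (\<forall>x\<in>D. entropy_vars s (\<omega> x) \<bullet> divergence (f \<circ> \<omega>) x = divergence (fe \<circ> \<omega>) x))"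


section \<open>The overset domain problem\<close>

locale overset_geometry =
  fixes \<Omega>u \<Omega>v \<Gamma>a \<Gamma>b \<Gamma>c \<Gamma>d :: "(real^'d) set"
    and na nb nc nd :: "real^'d \<Rightarrow> real^'d"
  assumes domains: "open \<Omega>u" "bounded \<Omega>u" "open \<Omega>v" "bounded \<Omega>v"
    and borel: "\<Gamma>a \<in> sets borel" "\<Gamma>b \<in> sets borel" "\<Gamma>c \<in> sets borel" "\<Gamma>d \<in> sets borel"
    and almost_disjoint:
      "\<Gamma>a \<inter> \<Gamma>b \<in> null_sets surface_measure" "\<Gamma>a \<inter> \<Gamma>c \<in> null_sets surface_measure"
      "\<Gamma>a \<inter> \<Gamma>d \<in> null_sets surface_measure" "\<Gamma>b \<inter> \<Gamma>c \<in> null_sets surface_measure"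
      "\<Gamma>b \<inter> \<Gamma>d \<in> null_sets surface_measure" "\<Gamma>c \<inter> \<Gamma>d \<in> null_sets surface_measure"
    and boundary: "frontier (\<Omega>u \<union> \<Omega>v) = \<Gamma>a \<union> \<Gamma>d"
    and boundary_u: "frontier \<Omega>u = \<Gamma>a \<union> \<Gamma>c"
    and boundary_v: "frontier \<Omega>v = \<Gamma>b \<union> \<Gamma>d"
    and boundary_only_u: "frontier (\<Omega>u - \<Omega>u \<inter> \<Omega>v) = \<Gamma>a \<union> \<Gamma>b"
    and boundary_overlap: "frontier (\<Omega>u \<inter> \<Omega>v) = \<Gamma>b \<union> \<Gamma>c"
    and boundary_only_v: "frontier (\<Omega>v - \<Omega>u \<inter> \<Omega>v) = \<Gamma>c \<union> \<Gamma>d"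
    and normals_u: "outward_normal_field \<Omega>u \<Gamma>a na" "outward_normal_field \<Omega>u \<Gamma>c nc"
    and normals_v: "outward_normal_field \<Omega>v \<Gamma>b nb" "outward_normal_field \<Omega>v \<Gamma>d nd"
    and normals_overlap:
      "outward_normal_field (\<Omega>u \<inter> \<Omega>v) \<Gamma>b nb" "outward_normal_field (\<Omega>u \<inter> \<Omega>v) \<Gamma>c nc"
    and gauss: "gauss_regular \<Omega>u" "gauss_regular \<Omega>v" "gauss_regular (\<Omega>u \<inter> \<Omega>v)"

definition penalty_function ::
  "(real^'p) set \<Rightarrow> (real^'d) set \<Rightarrow> (real^'d \<Rightarrow> real^'p \<Rightarrow> real^'p \<Rightarrow> real^'p) \<Rightarrow> bool" where
  "penalty_function W \<Gamma> P \<longleftrightarrow> (\<forall>x\<in>\<Gamma>. \<forall>\<omega>\<in>W. P x \<omega> \<omega> = 0)"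

definition lifting ::
  "(real^'d) set \<Rightarrow> (real^'d \<Rightarrow> real^'p) \<Rightarrow> (real^'d \<Rightarrow> real^'p) \<Rightarrow> real" where
  "lifting \<Gamma> q \<psi> = surface_integral \<Gamma> (\<lambda>x. \<psi> x \<bullet> q x)"

text \<open>In the next two definitions \<open>Dt \<phi>\<close> stands for the pairing of \<open>\<phi>\<close> with the time
  derivative of \<open>u\<close> over the region. Because of the surface terms the time derivative is not a
  function, so it enters as a functional on test functions. The surface data \<open>qb\<close> and
  \<open>qc\<close> are the penalties along the two interfaces.\<close>

definition penalised_weak_form ::
  "(real^'p \<Rightarrow> (real^'p)^'d) \<Rightarrow> (real^'d) set \<Rightarrow> (real^'d) set \<Rightarrow> (real^'d) set \<Rightarrow>
   ((real^'d \<Rightarrow> real^'p) \<Rightarrow> real) \<Rightarrow> (real^'d \<Rightarrow> real^'p) \<Rightarrow>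
   (real^'d \<Rightarrow> real^'p) \<Rightarrow> (real^'d \<Rightarrow> real^'p) \<Rightarrow> bool" where
  "penalised_weak_form f \<Omega> \<Gamma>b \<Gamma>c Dt u qb qc \<longleftrightarrow>
     set_integrable surface_measure \<Gamma>b qb \<and> set_integrable surface_measure \<Gamma>c qc \<and>
     (\<forall>\<phi>. continuous_on (closure \<Omega>) \<phi> \<longrightarrow>
        Dt \<phi> + (LINT x:\<Omega>|lborel. \<phi> x \<bullet> divergence (f \<circ> u) x)
          + lifting \<Gamma>b qb \<phi> + lifting \<Gamma>c qc \<phi> = 0)"

definition unpenalised_weak_form ::
  "(real^'p \<Rightarrow> (real^'p)^'d) \<Rightarrow> (real^'d) set \<Rightarrow>
   ((real^'d \<Rightarrow> real^'p) \<Rightarrow> real) \<Rightarrow> (real^'d \<Rightarrow> real^'p) \<Rightarrow> bool" where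
  "unpenalised_weak_form f \<Omega> Dt u \<longleftrightarrow>
     (\<forall>\<phi>. continuous_on (closure \<Omega>) \<phi> \<longrightarrow>
        Dt \<phi> + (LINT x:\<Omega>|lborel. \<phi> x \<bullet> divergence (f \<circ> u) x) = 0)"

text \<open>The state at one instant of time. \<open>Dtu\<close> and \<open>Dtv\<close> are the pairings over the whole domains,
  \<open>DtuO\<close> and \<open>DtvO\<close> those over the overlap. They are separate data, since by convention the
  penalties do not act on the overlap.\<close>

definition overset_solution_at ::
  "(real^'p) set \<Rightarrow> (real^'p \<Rightarrow> (real^'p)^'d) \<Rightarrow>
   (real^'d) set \<Rightarrow> (real^'d) set \<Rightarrow> (real^'d) set \<Rightarrow> (real^'d) set \<Rightarrow>
   (real^'d \<Rightarrow> real^'p \<Rightarrow> real^'p \<Rightarrow> real^'p) \<Rightarrow> (real^'d \<Rightarrow> real^'p \<Rightarrow> real^'p \<Rightarrow> real^'p) \<Rightarrow>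
   (real^'d \<Rightarrow> real^'p \<Rightarrow> real^'p \<Rightarrow> real^'p) \<Rightarrow> (real^'d \<Rightarrow> real^'p \<Rightarrow> real^'p \<Rightarrow> real^'p) \<Rightarrow>
   (real^'d \<Rightarrow> real^'p) \<Rightarrow> (real^'d \<Rightarrow> real^'p) \<Rightarrow>
   ((real^'d \<Rightarrow> real^'p) \<Rightarrow> real) \<Rightarrow> ((real^'d \<Rightarrow> real^'p) \<Rightarrow> real) \<Rightarrow>
   ((real^'d \<Rightarrow> real^'p) \<Rightarrow> real) \<Rightarrow> ((real^'d \<Rightarrow> real^'p) \<Rightarrow> real) \<Rightarrow> bool" where
  "overset_solution_at W f \<Omega>u \<Omega>v \<Gamma>b \<Gamma>c Pbu Pbv Pcu Pcv u v Dtu Dtv DtuO DtvO \<longleftrightarrow>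
     C1_closure \<Omega>u u \<and> u ` closure \<Omega>u \<subseteq> W \<and>
     C1_closure \<Omega>v v \<and> v ` closure \<Omega>v \<subseteq> W \<and>
     penalised_weak_form f \<Omega>u \<Gamma>b \<Gamma>c Dtu u
       (\<lambda>x. Pbu x (u x) (v x)) (\<lambda>x. Pcu x (u x) (v x)) \<and>
     penalised_weak_form f \<Omega>v \<Gamma>b \<Gamma>c Dtv v
       (\<lambda>x. Pbv x (u x) (v x)) (\<lambda>x. Pcv x (u x) (v x)) \<and>
     unpenalised_weak_form f (\<Omega>u \<inter> \<Omega>v) DtuO u \<and>
     unpenalised_weak_form f (\<Omega>u \<inter> \<Omega>v) DtvO v"


section \<open>Total entropy and interface condition\<close>

definition entropy_density ::
  "real \<Rightarrow> (real^'p \<Rightarrow> real) \<Rightarrow> (real^'d) set \<Rightarrow> (real^'d) set \<Rightarrow>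
   (real^'d \<Rightarrow> real^'p) \<Rightarrow> (real^'d \<Rightarrow> real^'p) \<Rightarrow> real^'d \<Rightarrow> real" where
  "entropy_density \<eta> s \<Omega>u \<Omega>v u v x =
     (if x \<in> \<Omega>u \<inter> \<Omega>v then (1 - \<eta>) * s (u x) + \<eta> * s (v x)
      else if x \<in> \<Omega>u then s (u x) else s (v x))"

definition total_entropy ::
  "real \<Rightarrow> (real^'p \<Rightarrow> real) \<Rightarrow> (real^'d) set \<Rightarrow> (real^'d) set \<Rightarrow>
   (real^'d \<Rightarrow> real^'p) \<Rightarrow> (real^'d \<Rightarrow> real^'p) \<Rightarrow> real" where
  "total_entropy \<eta> s \<Omega>u \<Omega>v u v = (LINT x:\<Omega>u \<union> \<Omega>v|lborel. entropy_density \<eta> s \<Omega>u \<Omega>v u v x)"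

text \<open>The time derivative of the total entropy, expressed by the pairings that define the weak
  time derivatives. It is the pairing of \<open>\<partial>\<^sub>t S\<close> with the constant 1, where the contributions
  of the two outer regions are written as whole region minus overlap.\<close>

definition total_entropy_rate ::
  "real \<Rightarrow> (real^'p \<Rightarrow> real) \<Rightarrow> (real^'d \<Rightarrow> real^'p) \<Rightarrow> (real^'d \<Rightarrow> real^'p) \<Rightarrow>
   ((real^'d \<Rightarrow> real^'p) \<Rightarrow> real) \<Rightarrow> ((real^'d \<Rightarrow> real^'p) \<Rightarrow> real) \<Rightarrow>
   ((real^'d \<Rightarrow> real^'p) \<Rightarrow> real) \<Rightarrow> ((real^'d \<Rightarrow> real^'p) \<Rightarrow> real) \<Rightarrow> real" where
  "total_entropy_rate \<eta> s u v Dtu Dtv DtuO DtvO =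
     Dtu (entropy_vars s \<circ> u) + Dtv (entropy_vars s \<circ> v)
       - \<eta> * DtuO (entropy_vars s \<circ> u) - (1 - \<eta>) * DtvO (entropy_vars s \<circ> v)"

definition interface_term ::
  "(real^'p \<Rightarrow> real) \<Rightarrow> (real^'p \<Rightarrow> real^'d) \<Rightarrow> (real^'d \<Rightarrow> real^'d) \<Rightarrow>
   (real^'d \<Rightarrow> real^'p \<Rightarrow> real^'p \<Rightarrow> real^'p) \<Rightarrow> (real^'d \<Rightarrow> real^'p \<Rightarrow> real^'p \<Rightarrow> real^'p) \<Rightarrow>
   (real^'d \<Rightarrow> real^'p) \<Rightarrow> (real^'d \<Rightarrow> real^'p) \<Rightarrow> real^'d \<Rightarrow> real" where
  "interface_term s fe \<beta> Pu Pv u v x =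
     (fe (u x) - fe (v x)) \<bullet> \<beta> x
       + entropy_vars s (u x) \<bullet> Pu x (u x) (v x) + entropy_vars s (v x) \<bullet> Pv x (u x) (v x)"

end

theory Submission
  imports Defs
begin

text \<open>
  The entropy rate is obtained by testing the weak forms with the entropy variables
  \<open>\<phi> = w(u)\<close> and \<open>\<phi> = w(v)\<close>. The entropy pair turns each volume term \<open>w \<bullet> div f\<close> into the
  divergence of the entropy flux, and Gauss' law moves it to the boundary
  (\<open>entropy_flux_balance\<close>). Over \<open>\<Omega>u\<close>, over \<open>\<Omega>v\<close>, and twice over the overlap, with weights
  \<open>\<eta>\<close> for \<open>u\<close> and \<open>1 - \<eta>\<close> for \<open>v\<close>, this leaves flux integrals along the four boundary pieces:
  \<open>\<Gamma>a\<close> and \<open>\<Gamma>d\<close> occur once each and form the asserted bound. The weights are such that on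
  each interface only the jump of the flux survives, since

    \<open>-fe(v) \<bullet> nb + \<eta> fe(u) \<bullet> nb + (1 - \<eta>) fe(v) \<bullet> nb = \<eta> (fe(u) - fe(v)) \<bullet> nb\<close> on \<open>\<Gamma>b\<close>,

    \<open>-fe(u) \<bullet> nc + \<eta> fe(u) \<bullet> nc + (1 - \<eta>) fe(v) \<bullet> nc = -(1 - \<eta>) (fe(u) - fe(v)) \<bullet> nc\<close> on \<open>\<Gamma>c\<close>.

  Together with the penalties these are exactly the integrals of minus the interface term,
  so the entropy rate equals the bound minus two integrals (\<open>entropy_rate_identity\<close>), which
  are nonnegative by hypothesis.

  Analytically, two things are needed. The entropy variables and the composed entropy flux must
  be regular up to the boundary, to serve as a test function and as a field in Gauss' law.
  And every surface integrand must be integrable by itself, so that the integrals may be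
  recombined: the flux terms are so by Gauss' law, the penalty terms because the entropy
  variables are bounded on a compact closure (\<open>set_integrable_inner_continuous\<close>).
\<close>

section \<open>Regularity up to the boundary\<close>

lemma C1_closure_imp_C1_on: "C1_closure D F \<Longrightarrow> C1_on D F"
  unfolding C1_closure_def C1_on_def
  by (meson closure_subset continuous_on_subset)

lemma C1_closure_subset:
  assumes "C1_closure D F" and "E \<subseteq> D"
  shows "C1_closure E F"
  using assms unfolding C1_closure_def
  by (meson closure_mono continuous_on_subset subsetD)

lemma C1_on_imp_continuous_on:
  assumes "C1_on D F"
  shows "continuous_on D F"
  using assms unfolding C1_on_def
  by (meson continuous_at_imp_continuous_on has_derivative_continuous)

lemma C1_closure_compose:
  assumes G: "C1_on W G" and F: "C1_closure D F" and sub: "F ` closure D \<subseteq> W"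
  shows "C1_closure D (G \<circ> F)"
proof -
  obtain G' where G': "\<And>y. y \<in> W \<Longrightarrow> (G has_derivative blinfun_apply (G' y)) (at y)"
    and contG': "continuous_on W G'"
    using G unfolding C1_on_def by blast
  obtain F' where F': "\<And>x. x \<in> D \<Longrightarrow> (F has_derivative blinfun_apply (F' x)) (at x)"
    and contF': "continuous_on (closure D) F'" and contF: "continuous_on (closure D) F"
    using F unfolding C1_closure_def by blast
  have "continuous_on (closure D) (G \<circ> F)"
    using C1_on_imp_continuous_on[OF G] contF sub
    by (meson continuous_on_compose continuous_on_subset)
  moreover have "((G \<circ> F) has_derivative blinfun_apply (G' (F x) o\<^sub>L F' x)) (at x)"
    if "x \<in> D" for x
  proof -
    have "F x \<in> W" using that sub closure_subset by blast
    then have "((G \<circ> F) has_derivative (blinfun_apply (G' (F x)) \<circ> blinfun_apply (F' x))) (at x)"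
      using F'[OF that] G' by (intro diff_chain_at) auto
    moreover have "blinfun_apply (G' (F x)) \<circ> blinfun_apply (F' x) = blinfun_apply (G' (F x) o\<^sub>L F' x)"
      by (auto simp: fun_eq_iff)
    ultimately show ?thesis by simp
  qed
  moreover have "continuous_on (closure D) (\<lambda>x. G' (F x) o\<^sub>L F' x)"
    using continuous_on_compose2[OF contG' contF sub] contF'
    by (rule bounded_bilinear.continuous_on[OF bounded_bilinear_blinfun_compose])
  ultimately show ?thesis
    unfolding C1_closure_def by (intro conjI exI[of _ "\<lambda>x. G' (F x) o\<^sub>L F' x"]) auto
qed

lemma continuous_on_entropy_vars:
  assumes "C1_on W s"
  shows "continuous_on W (entropy_vars s)"
proof -
  obtain s' where s': "\<And>y. y \<in> W \<Longrightarrow> (s has_derivative blinfun_apply (s' y)) (at y)"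
    and cont: "continuous_on W s'"
    using assms unfolding C1_on_def by blast
  have "continuous_on W (\<lambda>y. \<chi> j. blinfun_apply (s' y) (axis j 1))"
    by (intro continuous_intros cont)
  moreover have "entropy_vars s y = (\<chi> j. blinfun_apply (s' y) (axis j 1))" if "y \<in> W" for y
    using frechet_derivative_at[OF s'[OF that]] by (simp add: entropy_vars_def)
  ultimately show ?thesis
    by (subst continuous_on_cong[OF refl]) auto
qed


section \<open>Surface integrals\<close>

lemma sets_surface_measure [measurable_cong, simp]:
  "sets (surface_measure :: (real^'d) measure) = sets borel"
proof -
  have "sigma_sets (space borel) (sets borel) = sets (borel :: (real^'d) measure)"
    by (rule sets.sigma_sets_eq)
  then show ?thesis
    by (simp add: surface_measure_def hausdorff_measure_def sets_measure_of_conv)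
qed

text \<open>This makes penalty terms integrable: the entropy variables of a state are
  bounded on the compact closure of a domain, and the penalties are integrable.\<close>

lemma set_integrable_inner_continuous:
  fixes \<phi> q :: "real^'d \<Rightarrow> 'b::euclidean_space"
  assumes q: "set_integrable surface_measure \<Gamma> q" and \<Gamma>: "\<Gamma> \<in> sets borel"
    and K: "compact K" "\<Gamma> \<subseteq> K" and \<phi>: "continuous_on K \<phi>"
  shows "set_integrable surface_measure \<Gamma> (\<lambda>x. \<phi> x \<bullet> q x)"
proof -
  have "bounded (\<phi> ` K)"
    using compact_imp_bounded[OF compact_continuous_image[OF \<phi> K(1)]] .
  then obtain C where C: "\<And>x. x \<in> K \<Longrightarrow> norm (\<phi> x) \<le> C"
    unfolding bounded_iff by blast
  have "(\<lambda>x. indicator \<Gamma> x *\<^sub>R \<phi> x) \<in> borel_measurable borel"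
    using \<Gamma> continuous_on_subset[OF \<phi> K(2)] by (rule borel_measurable_continuous_on_indicator)
  then have [measurable]: "(\<lambda>x. indicator \<Gamma> x *\<^sub>R \<phi> x) \<in> borel_measurable surface_measure"
    by (simp add: measurable_cong_sets[OF sets_surface_measure refl])
  have qi: "integrable surface_measure (\<lambda>x. indicator \<Gamma> x *\<^sub>R q x)"
    using q by (simp add: set_integrable_def)
  note [measurable] = borel_measurable_integrable[OF qi]
  have "integrable surface_measure
     (\<lambda>x. (indicator \<Gamma> x *\<^sub>R \<phi> x) \<bullet> (indicator \<Gamma> x *\<^sub>R q x))"
  proof (rule Bochner_Integration.integrable_bound)
    show "integrable surface_measure (\<lambda>x. C * norm (indicator \<Gamma> x *\<^sub>R q x))"
      using qi by (intro integrable_mult_right integrable_norm)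
    have "norm (\<phi> x \<bullet> q x) \<le> \<bar>C * norm (q x)\<bar>" if "x \<in> \<Gamma>" for x
    proof -
      have "norm (\<phi> x \<bullet> q x) \<le> norm (\<phi> x) * norm (q x)"
        using Cauchy_Schwarz_ineq2 by simp
      also have "\<dots> \<le> C * norm (q x)"
        using C that K(2) by (intro mult_right_mono) auto
      finally show ?thesis by simp
    qed
    then show "AE x in surface_measure. norm ((indicator \<Gamma> x *\<^sub>R \<phi> x) \<bullet> (indicator \<Gamma> x *\<^sub>R q x))
        \<le> norm (C * norm (indicator \<Gamma> x *\<^sub>R q x))"
      by (intro AE_I2) (auto simp: indicator_def)
  qed measurable
  moreover have "(\<lambda>x. (indicator \<Gamma> x *\<^sub>R \<phi> x) \<bullet> (indicator \<Gamma> x *\<^sub>R q x))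
      = (\<lambda>x. indicator \<Gamma> x *\<^sub>R (\<phi> x \<bullet> q x))"
    by (auto simp: indicator_def fun_eq_iff)
  ultimately show ?thesis
    by (simp add: set_integrable_def)
qed

lemma outward_normal_field_Un:
  fixes D A B :: "(real^'d) set"
  assumes A: "outward_normal_field D A nA" "A \<in> sets borel"
    and B: "outward_normal_field D B nB" "B \<in> sets borel"
  shows "outward_normal_field D (A \<union> B) (\<lambda>x. if x \<in> A then nA x else nB x)"
proof -
  have [measurable]: "(\<lambda>x. indicator A x *\<^sub>R nA x) \<in> borel_measurable borel"
      "(\<lambda>x. indicator B x *\<^sub>R nB x) \<in> borel_measurable borel"
    using A(1) B(1) by (auto simp: outward_normal_field_def set_borel_measurable_def)
  have [measurable]: "A \<in> sets borel" using A(2) .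
  have "(\<lambda>x. indicator A x *\<^sub>R nA x + indicator (- A) x *\<^sub>R (indicator B x *\<^sub>R nB x)) \<in> borel_measurable borel"
    by measurable
  moreover have "(\<lambda>x. indicator (A \<union> B) x *\<^sub>R (if x \<in> A then nA x else nB x))
      = (\<lambda>x. indicator A x *\<^sub>R nA x + indicator (- A) x *\<^sub>R (indicator B x *\<^sub>R nB x))"
    by (auto simp: indicator_def fun_eq_iff)
  moreover have "AE x in surface_measure. x \<in> A \<union> B \<longrightarrow>
      outward_unit_normal D x (if x \<in> A then nA x else nB x)"
    using A(1) B(1) unfolding outward_normal_field_def by (auto elim: AE_mp)
  ultimately show ?thesis
    unfolding outward_normal_field_def set_borel_measurable_def by simp
qed

text \<open>Gauss' law concerns one normal field on the whole frontier. Gluing the fields of the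
  two pieces on \<open>A \<inter> B\<close> in favour of \<open>A\<close> disturbs \<open>nB\<close> only on a null set; gluing them the
  other way shows that the flux through \<open>B\<close> is integrable as well.\<close>

lemma gauss_two_pieces:
  fixes D A B :: "(real^'d) set" and F :: "real^'d \<Rightarrow> real^'d"
  assumes gauss: "gauss_regular D" and frontier: "frontier D = A \<union> B"
    and A: "A \<in> sets borel" "outward_normal_field D A nA"
    and B: "B \<in> sets borel" "outward_normal_field D B nB"
    and null: "A \<inter> B \<in> null_sets surface_measure"
    and F: "C1_closure D F"
  shows "set_integrable surface_measure A (\<lambda>x. F x \<bullet> nA x)"
    and "set_integrable surface_measure B (\<lambda>x. F x \<bullet> nB x)"
    and "(LINT x:D|lborel. divergence F x)
      = surface_integral A (\<lambda>x. F x \<bullet> nA x) + surface_integral B (\<lambda>x. F x \<bullet> nB x)"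
proof -
  define n where "n = (\<lambda>x. if x \<in> A then nA x else nB x)"
  define n' where "n' = (\<lambda>x. if x \<in> B then nB x else nA x)"
  have sets: "A \<in> sets surface_measure" "B \<in> sets surface_measure"
    using A(1) B(1) by auto
  have "outward_normal_field D (frontier D) n"
    unfolding n_def frontier by (rule outward_normal_field_Un[OF A(2,1) B(2,1)])
  then have int: "set_integrable surface_measure (A \<union> B) (\<lambda>x. F x \<bullet> n x)"
    and eq: "(LINT x:D|lborel. divergence F x) = surface_integral (A \<union> B) (\<lambda>x. F x \<bullet> n x)"
    using gauss F frontier unfolding gauss_regular_def by auto
  have "frontier D = B \<union> A" using frontier by blast
  then have "outward_normal_field D (frontier D) n'"
    unfolding n'_def by (simp only:) (rule outward_normal_field_Un[OF B(2,1) A(2,1)])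
  then have int': "set_integrable surface_measure (A \<union> B) (\<lambda>x. F x \<bullet> n' x)"
    using gauss F frontier unfolding gauss_regular_def by auto

  have int_A: "set_integrable surface_measure A (\<lambda>x. F x \<bullet> n x)"
    and int_B: "set_integrable surface_measure B (\<lambda>x. F x \<bullet> n x)"
    and int'_B: "set_integrable surface_measure B (\<lambda>x. F x \<bullet> n' x)"
    using set_integrable_subset[OF int] set_integrable_subset[OF int'] sets by simp_all
  have "set_integrable surface_measure A (\<lambda>x. F x \<bullet> n x)
      \<longleftrightarrow> set_integrable surface_measure A (\<lambda>x. F x \<bullet> nA x)"
    by (rule set_integrable_cong) (simp_all add: n_def)
  then show "set_integrable surface_measure A (\<lambda>x. F x \<bullet> nA x)"
    using int_A by simp
  have "set_integrable surface_measure B (\<lambda>x. F x \<bullet> n' x)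
      \<longleftrightarrow> set_integrable surface_measure B (\<lambda>x. F x \<bullet> nB x)"
    by (rule set_integrable_cong) (simp_all add: n'_def)
  then show flux_B: "set_integrable surface_measure B (\<lambda>x. F x \<bullet> nB x)"
    using int'_B by simp

  have AE: "AE x in surface_measure. x \<notin> A \<inter> B"
    using null by (rule AE_not_in)
  have "surface_integral (A \<union> B) (\<lambda>x. F x \<bullet> n x)
      = surface_integral A (\<lambda>x. F x \<bullet> n x) + surface_integral B (\<lambda>x. F x \<bullet> n x)"
    unfolding surface_integral_def using AE sets int_A int_B
    by (intro set_integral_Un_AE) auto
  also have "surface_integral A (\<lambda>x. F x \<bullet> n x) = surface_integral A (\<lambda>x. F x \<bullet> nA x)"
    unfolding surface_integral_def using sets(1)
    by (rule set_lebesgue_integral_cong) (simp add: n_def)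
  also have "surface_integral B (\<lambda>x. F x \<bullet> n x) = surface_integral B (\<lambda>x. F x \<bullet> nB x)"
    unfolding surface_integral_def set_lebesgue_integral_def
  proof (rule integral_cong_AE)
    show "AE x in surface_measure. indicator B x *\<^sub>R (F x \<bullet> n x) = indicator B x *\<^sub>R (F x \<bullet> nB x)"
      using AE by eventually_elim (auto simp: n_def indicator_def)
  qed (use int_B flux_B in \<open>auto simp: set_integrable_def dest: borel_measurable_integrable\<close>)
  finally show "(LINT x:D|lborel. divergence F x)
      = surface_integral A (\<lambda>x. F x \<bullet> nA x) + surface_integral B (\<lambda>x. F x \<bullet> nB x)"
    using eq by simp
qed


section \<open>Entropy balance\<close>

text \<open>Contracting the flux with the entropy variables leaves a pure divergence, so over a
  region the contraction is worth the entropy flux through its two boundary pieces.\<close>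

lemma entropy_flux_balance:
  fixes \<omega> :: "real^'d \<Rightarrow> real^'p" and f :: "real^'p \<Rightarrow> (real^'p)^'d"
  assumes pair: "entropy_pair W f s fe"
    and \<omega>: "C1_closure D \<omega>" "\<omega> ` closure D \<subseteq> W" and D: "open D" "gauss_regular D"
    and frontier: "frontier D = A \<union> B"
    and A: "A \<in> sets borel" "outward_normal_field D A nA"
    and B: "B \<in> sets borel" "outward_normal_field D B nB"
    and null: "A \<inter> B \<in> null_sets surface_measure"
  shows "set_integrable surface_measure A (\<lambda>x. fe (\<omega> x) \<bullet> nA x)"
    and "set_integrable surface_measure B (\<lambda>x. fe (\<omega> x) \<bullet> nB x)"
    and "(LINT x:D|lborel. (entropy_vars s \<circ> \<omega>) x \<bullet> divergence (f \<circ> \<omega>) x)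
      = surface_integral A (\<lambda>x. fe (\<omega> x) \<bullet> nA x) + surface_integral B (\<lambda>x. fe (\<omega> x) \<bullet> nB x)"
proof -
  have "C1_on W fe" using pair by (simp add: entropy_pair_def)
  then have "C1_closure D (fe \<circ> \<omega>)" using \<omega> by (rule C1_closure_compose)
  note gauss = gauss_two_pieces[OF D(2) frontier A B null this]
  show "set_integrable surface_measure A (\<lambda>x. fe (\<omega> x) \<bullet> nA x)"
    and "set_integrable surface_measure B (\<lambda>x. fe (\<omega> x) \<bullet> nB x)"
    using gauss(1,2) by simp_all
  have "\<omega> ` D \<subseteq> W" using \<omega>(2) closure_subset by blast
  then have "\<forall>x\<in>D. entropy_vars s (\<omega> x) \<bullet> divergence (f \<circ> \<omega>) x = divergence (fe \<circ> \<omega>) x"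
    using pair D(1) C1_closure_imp_C1_on[OF \<omega>(1)] unfolding entropy_pair_def by blast
  then have "(LINT x:D|lborel. (entropy_vars s \<circ> \<omega>) x \<bullet> divergence (f \<circ> \<omega>) x)
      = (LINT x:D|lborel. divergence (fe \<circ> \<omega>) x)"
    using D(1) by (intro set_lebesgue_integral_cong) auto
  with gauss(3) show "(LINT x:D|lborel. (entropy_vars s \<circ> \<omega>) x \<bullet> divergence (f \<circ> \<omega>) x)
      = surface_integral A (\<lambda>x. fe (\<omega> x) \<bullet> nA x) + surface_integral B (\<lambda>x. fe (\<omega> x) \<bullet> nB x)"
    by simp
qed

lemma surface_integral_interface_term:
  fixes u v :: "real^'d \<Rightarrow> real^'p"
  assumes "set_integrable surface_measure \<Gamma> (\<lambda>x. fe (u x) \<bullet> n x)"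
    and "set_integrable surface_measure \<Gamma> (\<lambda>x. fe (v x) \<bullet> n x)"
    and "set_integrable surface_measure \<Gamma> (\<lambda>x. entropy_vars s (u x) \<bullet> Pu x (u x) (v x))"
    and "set_integrable surface_measure \<Gamma> (\<lambda>x. entropy_vars s (v x) \<bullet> Pv x (u x) (v x))"
  shows "surface_integral \<Gamma> (interface_term s fe (\<lambda>x. k *\<^sub>R n x) Pu Pv u v)
    = k * (surface_integral \<Gamma> (\<lambda>x. fe (u x) \<bullet> n x) - surface_integral \<Gamma> (\<lambda>x. fe (v x) \<bullet> n x))
      + lifting \<Gamma> (\<lambda>x. Pu x (u x) (v x)) (entropy_vars s \<circ> u)
      + lifting \<Gamma> (\<lambda>x. Pv x (u x) (v x)) (entropy_vars s \<circ> v)"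
proof -
  have "interface_term s fe (\<lambda>x. k *\<^sub>R n x) Pu Pv u v
      = (\<lambda>x. k * (fe (u x) \<bullet> n x - fe (v x) \<bullet> n x)
          + entropy_vars s (u x) \<bullet> Pu x (u x) (v x) + entropy_vars s (v x) \<bullet> Pv x (u x) (v x))"
    by (auto simp: interface_term_def fun_eq_iff inner_diff_left)
  then show ?thesis
    unfolding surface_integral_def lifting_def o_def
    by (simp only: set_integral_add set_integral_diff set_integrable_mult_right set_integral_mult_right assms)
qed

text \<open>Inequalities enter only through the sign of the interface terms: the balance itself is
  an equality. In particular, vanishing interface terms preserve the entropy up to the physical
  boundary.\<close>

lemma entropy_rate_identity:
  fixes u v :: "real^'d \<Rightarrow> real^'p" and f :: "real^'p \<Rightarrow> (real^'p)^'d"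
  assumes pair: "entropy_pair W f s fe"
    and geometry: "overset_geometry \<Omega>u \<Omega>v \<Gamma>a \<Gamma>b \<Gamma>c \<Gamma>d na nb nc nd"
    and sol: "overset_solution_at W f \<Omega>u \<Omega>v \<Gamma>b \<Gamma>c Pbu Pbv Pcu Pcv u v Dtu Dtv DtuO DtvO"
  shows "total_entropy_rate \<eta> s u v Dtu Dtv DtuO DtvO =
    - (surface_integral \<Gamma>a (\<lambda>x. fe (u x) \<bullet> na x) + surface_integral \<Gamma>d (\<lambda>x. fe (v x) \<bullet> nd x))
    - surface_integral \<Gamma>b (interface_term s fe (\<lambda>x. - \<eta> *\<^sub>R nb x) Pbu Pbv u v)
    - surface_integral \<Gamma>c (interface_term s fe (\<lambda>x. (1 - \<eta>) *\<^sub>R nc x) Pcu Pcv u v)"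
proof -
  interpret overset_geometry \<Omega>u \<Omega>v \<Gamma>a \<Gamma>b \<Gamma>c \<Gamma>d na nb nc nd by (rule geometry)
  let ?O = "\<Omega>u \<inter> \<Omega>v"
  let ?wu = "entropy_vars s \<circ> u" and ?wv = "entropy_vars s \<circ> v"
  have u: "C1_closure \<Omega>u u" "u ` closure \<Omega>u \<subseteq> W" and v: "C1_closure \<Omega>v v" "v ` closure \<Omega>v \<subseteq> W"
    and weak_u: "penalised_weak_form f \<Omega>u \<Gamma>b \<Gamma>c Dtu u (\<lambda>x. Pbu x (u x) (v x)) (\<lambda>x. Pcu x (u x) (v x))"
    and weak_v: "penalised_weak_form f \<Omega>v \<Gamma>b \<Gamma>c Dtv v (\<lambda>x. Pbv x (u x) (v x)) (\<lambda>x. Pcv x (u x) (v x))"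
    and weak_uO: "unpenalised_weak_form f ?O DtuO u" and weak_vO: "unpenalised_weak_form f ?O DtvO v"
    using sol by (auto simp: overset_solution_at_def)
  have closure_O: "closure ?O \<subseteq> closure \<Omega>u" "closure ?O \<subseteq> closure \<Omega>v"
    by (simp_all add: closure_mono)
  have uO: "C1_closure ?O u" "u ` closure ?O \<subseteq> W" and vO: "C1_closure ?O v" "v ` closure ?O \<subseteq> W"
    using C1_closure_subset[OF u(1)] C1_closure_subset[OF v(1)]
      subset_trans[OF image_mono[OF closure_O(1)] u(2)] subset_trans[OF image_mono[OF closure_O(2)] v(2)]
    by simp_all
  have openO: "open ?O" using domains by blast
  have "C1_on W s" using pair by (simp add: entropy_pair_def)
  note cont_w = continuous_on_entropy_vars[OF this]
  have cont_u: "continuous_on (closure \<Omega>u) ?wu"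
    using u cont_w unfolding C1_closure_def by (meson continuous_on_compose continuous_on_subset)
  have cont_v: "continuous_on (closure \<Omega>v) ?wv"
    using v cont_w unfolding C1_closure_def by (meson continuous_on_compose continuous_on_subset)
  have cont_O: "continuous_on (closure ?O) ?wu" "continuous_on (closure ?O) ?wv"
    using cont_u cont_v closure_O by (meson continuous_on_subset)+

  have "\<Gamma>b \<union> \<Gamma>c \<subseteq> closure ?O" using boundary_overlap by (auto simp: frontier_def)
  \<comment> \<open>Both interfaces bound the overlap, so both states have boundary values on each of them.\<close>
  then have interfaces: "\<Gamma>b \<subseteq> closure ?O" "\<Gamma>c \<subseteq> closure ?O" by auto
  have compactO: "compact (closure ?O)" using domains by (simp add: bounded_Int compact_closure)
  have penalty_int: "set_integrable surface_measure \<Gamma>b (\<lambda>x. ?wu x \<bullet> Pbu x (u x) (v x))"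
      "set_integrable surface_measure \<Gamma>c (\<lambda>x. ?wu x \<bullet> Pcu x (u x) (v x))"
      "set_integrable surface_measure \<Gamma>b (\<lambda>x. ?wv x \<bullet> Pbv x (u x) (v x))"
      "set_integrable surface_measure \<Gamma>c (\<lambda>x. ?wv x \<bullet> Pcv x (u x) (v x))"
    using weak_u weak_v
      set_integrable_inner_continuous[OF _ borel(2) compactO interfaces(1) cont_O(1)]
      set_integrable_inner_continuous[OF _ borel(3) compactO interfaces(2) cont_O(1)]
      set_integrable_inner_continuous[OF _ borel(2) compactO interfaces(1) cont_O(2)]
      set_integrable_inner_continuous[OF _ borel(3) compactO interfaces(2) cont_O(2)]
    unfolding penalised_weak_form_def by simp_all

  note balance_u = entropy_flux_balance[OF pair u domains(1) gauss(1) boundary_u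
      borel(1) normals_u(1) borel(3) normals_u(2) almost_disjoint(2)]
  note balance_v = entropy_flux_balance[OF pair v domains(3) gauss(2) boundary_v
      borel(2) normals_v(1) borel(4) normals_v(2) almost_disjoint(5)]
  note balance_uO = entropy_flux_balance[OF pair uO openO gauss(3) boundary_overlap
      borel(2) normals_overlap(1) borel(3) normals_overlap(2) almost_disjoint(4)]
  note balance_vO = entropy_flux_balance[OF pair vO openO gauss(3) boundary_overlap
      borel(2) normals_overlap(1) borel(3) normals_overlap(2) almost_disjoint(4)]

  let ?au = "surface_integral \<Gamma>a (\<lambda>x. fe (u x) \<bullet> na x)"
  let ?bu = "surface_integral \<Gamma>b (\<lambda>x. fe (u x) \<bullet> nb x)"
  let ?cu = "surface_integral \<Gamma>c (\<lambda>x. fe (u x) \<bullet> nc x)"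
  let ?bv = "surface_integral \<Gamma>b (\<lambda>x. fe (v x) \<bullet> nb x)"
  let ?cv = "surface_integral \<Gamma>c (\<lambda>x. fe (v x) \<bullet> nc x)"
  let ?dv = "surface_integral \<Gamma>d (\<lambda>x. fe (v x) \<bullet> nd x)"
  let ?pbu = "lifting \<Gamma>b (\<lambda>x. Pbu x (u x) (v x)) ?wu" and ?pcu = "lifting \<Gamma>c (\<lambda>x. Pcu x (u x) (v x)) ?wu"
  let ?pbv = "lifting \<Gamma>b (\<lambda>x. Pbv x (u x) (v x)) ?wv" and ?pcv = "lifting \<Gamma>c (\<lambda>x. Pcv x (u x) (v x)) ?wv"

  have "Dtu ?wu + (LINT x:\<Omega>u|lborel. ?wu x \<bullet> divergence (f \<circ> u) x) + ?pbu + ?pcu = 0"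
    using weak_u cont_u unfolding penalised_weak_form_def by blast
  then have rate_u: "Dtu ?wu = - (?au + ?cu) - ?pbu - ?pcu"
    using balance_u(3) by linarith
  have "Dtv ?wv + (LINT x:\<Omega>v|lborel. ?wv x \<bullet> divergence (f \<circ> v) x) + ?pbv + ?pcv = 0"
    using weak_v cont_v unfolding penalised_weak_form_def by blast
  then have rate_v: "Dtv ?wv = - (?bv + ?dv) - ?pbv - ?pcv"
    using balance_v(3) by linarith
  have "DtuO ?wu + (LINT x:?O|lborel. ?wu x \<bullet> divergence (f \<circ> u) x) = 0"
    using weak_uO cont_O unfolding unpenalised_weak_form_def by blast
  then have rate_uO: "DtuO ?wu = - (?bu + ?cu)"
    using balance_uO(3) by linarith
  have "DtvO ?wv + (LINT x:?O|lborel. ?wv x \<bullet> divergence (f \<circ> v) x) = 0"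
    using weak_vO cont_O unfolding unpenalised_weak_form_def by blast
  then have rate_vO: "DtvO ?wv = - (?bv + ?cv)"
    using balance_vO(3) by linarith

  have interface_b: "surface_integral \<Gamma>b (interface_term s fe (\<lambda>x. - \<eta> *\<^sub>R nb x) Pbu Pbv u v)
      = - \<eta> * (?bu - ?bv) + ?pbu + ?pbv"
    using balance_uO(1) balance_vO(1) penalty_int
    by (intro surface_integral_interface_term) (simp_all add: o_def)
  have interface_c: "surface_integral \<Gamma>c (interface_term s fe (\<lambda>x. (1 - \<eta>) *\<^sub>R nc x) Pcu Pcv u v)
      = (1 - \<eta>) * (?cu - ?cv) + ?pcu + ?pcv"
    using balance_uO(2) balance_vO(2) penalty_int
    by (intro surface_integral_interface_term) (simp_all add: o_def)
  show ?thesis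
    unfolding total_entropy_rate_def rate_u rate_v rate_uO rate_vO interface_b interface_c
    by (simp add: algebra_simps)
qed

lemma surface_integral_nonneg:
  assumes "\<And>x. x \<in> \<Gamma> \<Longrightarrow> 0 \<le> g x"
  shows "0 \<le> surface_integral \<Gamma> g"
  unfolding surface_integral_def set_lebesgue_integral_def
  using assms by (intro Bochner_Integration.integral_nonneg) (auto simp: indicator_def)

theorem theorem1:
  fixes W :: "(real^'p) set"
    and f :: "real^'p \<Rightarrow> (real^'p)^'d"
    and s :: "real^'p \<Rightarrow> real"
    and fe :: "real^'p \<Rightarrow> real^'d"
    and \<Omega>u \<Omega>v \<Gamma>a \<Gamma>b \<Gamma>c \<Gamma>d :: "(real^'d) set"
    and na nb nc nd :: "real^'d \<Rightarrow> real^'d"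
    and Pbu Pbv Pcu Pcv :: "real^'d \<Rightarrow> real^'p \<Rightarrow> real^'p \<Rightarrow> real^'p"
    and T :: "real set"
    and u v :: "real \<Rightarrow> real^'d \<Rightarrow> real^'p"
    and Dtu Dtv DtuO DtvO :: "real \<Rightarrow> (real^'d \<Rightarrow> real^'p) \<Rightarrow> real"
    and \<eta> :: real
  assumes "open W" and "C1_on W f" and "entropy_pair W f s fe"
    and "overset_geometry \<Omega>u \<Omega>v \<Gamma>a \<Gamma>b \<Gamma>c \<Gamma>d na nb nc nd"
    and "penalty_function W \<Gamma>b Pbu" and "penalty_function W \<Gamma>b Pbv"
    and "penalty_function W \<Gamma>c Pcu" and "penalty_function W \<Gamma>c Pcv"
    and "\<And>t. t \<in> T \<Longrightarrow>
      overset_solution_at W f \<Omega>u \<Omega>v \<Gamma>b \<Gamma>c Pbu Pbv Pcu Pcv (u t) (v t)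
        (Dtu t) (Dtv t) (DtuO t) (DtvO t)"
    and "0 < \<eta>" and "\<eta> < 1"
    and "\<And>t x. t \<in> T \<Longrightarrow> x \<in> \<Gamma>b \<Longrightarrow>
      0 \<le> interface_term s fe (\<lambda>x. - \<eta> *\<^sub>R nb x) Pbu Pbv (u t) (v t) x"
    and "\<And>t x. t \<in> T \<Longrightarrow> x \<in> \<Gamma>c \<Longrightarrow>
      0 \<le> interface_term s fe (\<lambda>x. (1 - \<eta>) *\<^sub>R nc x) Pcu Pcv (u t) (v t) x"
  shows "\<forall>t\<in>T.
    (let dSdt = total_entropy_rate \<eta> s (u t) (v t) (Dtu t) (Dtv t) (DtuO t) (DtvO t);
         bound = - (surface_integral \<Gamma>a (\<lambda>x. fe (u t x) \<bullet> na x)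
                    + surface_integral \<Gamma>d (\<lambda>x. fe (v t x) \<bullet> nd x))
     in dSdt \<le> bound \<and>
        (((\<lambda>\<tau>. total_entropy \<eta> s \<Omega>u \<Omega>v (u \<tau>) (v \<tau>)) has_real_derivative dSdt) (at t) \<longrightarrow>
         deriv (\<lambda>\<tau>. total_entropy \<eta> s \<Omega>u \<Omega>v (u \<tau>) (v \<tau>)) t \<le> bound))"
proof -
  have bound: "total_entropy_rate \<eta> s (u t) (v t) (Dtu t) (Dtv t) (DtuO t) (DtvO t)
      \<le> - (surface_integral \<Gamma>a (\<lambda>x. fe (u t x) \<bullet> na x)
          + surface_integral \<Gamma>d (\<lambda>x. fe (v t x) \<bullet> nd x))" if "t \<in> T" for t
    using entropy_rate_identity[OF assms(3,4) assms(9)[OF that], of \<eta>]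
      surface_integral_nonneg[of \<Gamma>b "interface_term s fe (\<lambda>x. - \<eta> *\<^sub>R nb x) Pbu Pbv (u t) (v t)"]
      surface_integral_nonneg[of \<Gamma>c "interface_term s fe (\<lambda>x. (1 - \<eta>) *\<^sub>R nc x) Pcu Pcv (u t) (v t)"]
      assms(12,13)[OF that]
    by fastforce
  then show ?thesis
    by (auto simp: Let_def dest: DERIV_imp_deriv)
qed

end
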